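(* Assume $q_S=1$ (so $q_1=q_2=0$) and $y\in(Y_L,Y_S)$. For $\gamma>0$ denote $p_\gamma(y):=P_{1,\gamma}(y)=P_{2,\gamma}(y)$. Then $p_\gamma(y)\le p_0(y)$ and furthermore $$\lim_{\gamma\downarrow0}p_\gamma(y)=p_0(y)\quad\text{and}\quad\lim_{\gamma\uparrow\infty}p_\gamma(y)=0.$$
   Context: Constants: $r\in\mathbb{R}$, $\eta>0$, $\delta>0$, $K>0$, $0<D_2<D_1$; $$\beta:=\Big(\tfrac12-\tfrac{r-\delta}{\eta^2}\Big)+\sqrt{\Big(\tfrac12-\tfrac{r-\delta}{\eta^2}\Big)^2+\tfrac{2r}{\eta^2}}>1,\qquad Y_F:=\frac{\delta K\beta}{D_2(\beta-1)}.$$ For $y>0$: $F(y)=\frac{K}{\beta-1}(y/Y_F)^\beta$ if $y\le Y_F$, $F(y)=\frac{D_2y}{\delta}-K$ if $y>Y_F$; $L(y)=\frac{D_1y}{\delta}-\frac{D_1-D_2}{D_2}\frac{K\beta}{\beta-1}(y/Y_F)^\beta-K$ if $y<Y_F$, $L(y)=\frac{D_2y}{\delta}-K$ if $y\ge Y_F$; $S(y)=\frac{D_2y}{\delta}-K$. $Y_L$ is the unique point of $(0,Y_F)$ such that $S<L<F$ for $y<Y_L$, $S<L=F$ at $Y_L$, $S<F<L$ on $(Y_L,Y_F)$; and $S=F=L$ for $y\ge Y_F$. Utility $U(x)=-\exp(-\gamma x)$ with $\gamma>0$; $l:=U(L)$, $f:=U(F)$, $s:=U(S)$ (depending on $\gamma$).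 For regulator probabilities $q_1,q_2,q_S\ge0$ with $q_1+q_2+q_S=1$, $$P_{i,\gamma}(y):=\frac{l(y)-f(y)}{q_i(l(y)-f(y))+q_S(l(y)-s(y))},\quad i=1,2,\qquad p_0(y):=\frac{L(y)-F(y)}{L(y)-S(y)}.$$ In the symmetric case $q_1=q_2=q$, $Y_S\in[Y_L,Y_F]$ denotes the point where $qL+qF+q_SS=F$; for $q=0$, $q_S=1$, this is $Y_S=Y_F$. *)

theory Defs
  imports "HOL-Analysis.Analysis"
begin

definition beta_exp :: "real \<Rightarrow> real \<Rightarrow> real \<Rightarrow> real" where
  "beta_exp r \<eta> \<delta> =
     (1/2 - (r - \<delta>) / \<eta>\<^sup>2) + sqrt ((1/2 - (r - \<delta>) / \<eta>\<^sup>2)\<^sup>2 + 2 * r / \<eta>\<^sup>2)"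

definition Y_F :: "real \<Rightarrow> real \<Rightarrow> real \<Rightarrow> real \<Rightarrow> real \<Rightarrow> real" where
  "Y_F r \<eta> \<delta> K D2 =
     (let \<beta> = beta_exp r \<eta> \<delta> in \<delta> * K * \<beta> / (D2 * (\<beta> - 1)))"

text \<open>Payoffs of the follower, the leader and of simultaneous investment; only values at
  \<^prop>\<open>y > 0\<close> are meaningful.\<close>

definition follower_val ::
  "real \<Rightarrow> real \<Rightarrow> real \<Rightarrow> real \<Rightarrow> real \<Rightarrow> real \<Rightarrow> real" where
  "follower_val r \<eta> \<delta> K D2 y =
     (let \<beta> = beta_exp r \<eta> \<delta>; yF = Y_F r \<eta> \<delta> K D2 in
        if y \<le> yF then K / (\<beta> - 1) * (y / yF) powr \<beta> else D2 * y / \<delta> - K)"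

definition leader_val ::
  "real \<Rightarrow> real \<Rightarrow> real \<Rightarrow> real \<Rightarrow> real \<Rightarrow> real \<Rightarrow> real \<Rightarrow> real" where
  "leader_val r \<eta> \<delta> K D1 D2 y =
     (let \<beta> = beta_exp r \<eta> \<delta>; yF = Y_F r \<eta> \<delta> K D2 in
        if y < yF
        then D1 * y / \<delta> - (D1 - D2) / D2 * (K * \<beta> / (\<beta> - 1)) * (y / yF) powr \<beta> - K
        else D2 * y / \<delta> - K)"

definition simul_val :: "real \<Rightarrow> real \<Rightarrow> real \<Rightarrow> real \<Rightarrow> real" where
  "simul_val \<delta> K D2 y = D2 * y / \<delta> - K"

definition is_Y_L ::
  "real \<Rightarrow> real \<Rightarrow> real \<Rightarrow> real \<Rightarrow> real \<Rightarrow> real \<Rightarrow> real \<Rightarrow> bool" where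
  "is_Y_L r \<eta> \<delta> K D1 D2 z \<longleftrightarrow>
     (let yF = Y_F r \<eta> \<delta> K D2; L = leader_val r \<eta> \<delta> K D1 D2;
          F = follower_val r \<eta> \<delta> K D2; S = simul_val \<delta> K D2 in
        z \<in> {0<..<yF} \<and>
        (\<forall>y\<in>{0<..<z}. S y < L y \<and> L y < F y) \<and>
        S z < L z \<and> L z = F z \<and>
        (\<forall>y\<in>{z<..<yF}. S y < F y \<and> F y < L y))"

definition Y_L :: "real \<Rightarrow> real \<Rightarrow> real \<Rightarrow> real \<Rightarrow> real \<Rightarrow> real \<Rightarrow> real" where
  "Y_L r \<eta> \<delta> K D1 D2 = (THE z. is_Y_L r \<eta> \<delta> K D1 D2 z)"

text \<open>The case of symmetric regulator probabilities \<open>q\<close>, \<open>q\<close>, \<open>qS\<close>. The equation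
  always has \<open>Y_F\<close> as a solution, because \<open>S = F = L\<close> there; for \<open>q > 0\<close> the threshold is
  the other solution, which is smaller, and for \<open>q = 0\<close> it is \<open>Y_F\<close> itself (see
  \<open>Y_S_regulator_simul\<close> below). Taking the least solution covers both cases.\<close>

definition Y_S ::
  "real \<Rightarrow> real \<Rightarrow> real \<Rightarrow> real \<Rightarrow> real \<Rightarrow> real \<Rightarrow> real \<Rightarrow> real \<Rightarrow> real" where
  "Y_S r \<eta> \<delta> K D1 D2 q qS =
     (LEAST z. z \<in> {Y_L r \<eta> \<delta> K D1 D2..Y_F r \<eta> \<delta> K D2} \<and>
        q * leader_val r \<eta> \<delta> K D1 D2 z + q * follower_val r \<eta> \<delta> K D2 z
          + qS * simul_val \<delta> K D2 z = follower_val r \<eta> \<delta> K D2 z)"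

definition utility :: "real \<Rightarrow> real \<Rightarrow> real" where
  "utility \<gamma> x = - exp (- \<gamma> * x)"

text \<open>\<open>qi\<close> is the regulator probability of the player \<open>i\<close> whose \<open>P\<^bsub>i,\<gamma>\<^esub>\<close> is formed.\<close>

definition P_util ::
  "real \<Rightarrow> real \<Rightarrow> real \<Rightarrow> real \<Rightarrow> real \<Rightarrow> real \<Rightarrow> real \<Rightarrow> real \<Rightarrow> real \<Rightarrow> real \<Rightarrow> real" where
  "P_util r \<eta> \<delta> K D1 D2 qi qS \<gamma> y =
     (let l = utility \<gamma> (leader_val r \<eta> \<delta> K D1 D2 y);
          f = utility \<gamma> (follower_val r \<eta> \<delta> K D2 y);
          s = utility \<gamma> (simul_val \<delta> K D2 y) in
        (l - f) / (qi * (l - f) + qS * (l - s)))"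

definition p_zero ::
  "real \<Rightarrow> real \<Rightarrow> real \<Rightarrow> real \<Rightarrow> real \<Rightarrow> real \<Rightarrow> real \<Rightarrow> real" where
  "p_zero r \<eta> \<delta> K D1 D2 y =
     (leader_val r \<eta> \<delta> K D1 D2 y - follower_val r \<eta> \<delta> K D2 y)
       / (leader_val r \<eta> \<delta> K D1 D2 y - simul_val \<delta> K D2 y)"

subsection \<open>The thresholds are well defined\<close>

lemma beta_exp_gt_1:
  assumes "\<eta> > 0" "\<delta> > 0"
  shows "beta_exp r \<eta> \<delta> > 1"
proof -
  define A where "A = 1/2 - (r - \<delta>) / \<eta>\<^sup>2"
  have "A\<^sup>2 + 2 * r / \<eta>\<^sup>2 = (1 - A)\<^sup>2 + 2 * \<delta> / \<eta>\<^sup>2"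
    using assms unfolding A_def by (simp add: power2_eq_square field_simps)
  moreover have "2 * \<delta> / \<eta>\<^sup>2 > 0" using assms by simp
  ultimately have "\<bar>1 - A\<bar> < sqrt (A\<^sup>2 + 2 * r / \<eta>\<^sup>2)"
    by (intro real_less_rsqrt) simp
  then show ?thesis unfolding beta_exp_def A_def[symmetric] by linarith
qed

lemma powr_lt_self:
  fixes x b :: real
  assumes "0 < x" "x < 1" "b > 1"
  shows "x powr b < x"
  using powr_less_mono'[of x 1 b] assms by simp

lemma powr_gt_tangent:
  fixes x b :: real
  assumes "0 < x" "x < 1" "b > 1"
  shows "b * x - (b - 1) < x powr b"
proof -
  let ?g = "\<lambda>x. x powr b - b * x"
  have "?g 1 < ?g x"
  proof (rule DERIV_neg_imp_decreasing_open[OF assms(2)])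
    fix t assume t: "x < t" "t < 1"
    then have "(?g has_real_derivative b * t powr (b - 1) - b) (at t)"
      using assms by (auto intro!: derivative_eq_intros)
    moreover have "t powr (b - 1) < 1"
      using t assms powr_less_mono2[of "b - 1" t 1] by auto
    ultimately show "\<exists>y. (?g has_real_derivative y) (at t) \<and> y < 0"
      using assms by (intro exI[of _ "b * t powr (b - 1) - b"]) auto
  next
    show "continuous_on {x..1} ?g" using assms by (intro continuous_intros) auto
  qed
  then show ?thesis by simp
qed

lemma single_crossing:
  fixes a b :: real
  assumes "a > 1" "b > 1"
  defines "h \<equiv> \<lambda>x. a * b * x - ((a - 1) * b + 1) * x powr b - (b - 1)"
  obtains z where "0 < z" "z < 1" "h z = 0"
    "\<And>x. 0 < x \<Longrightarrow> x < z \<Longrightarrow> h x < 0" "\<And>x. z < x \<Longrightarrow> x < 1 \<Longrightarrow> 0 < h x"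
proof -
  define C where "C = (a - 1) * b + 1"
  have "(a - 1) * 1 < (a - 1) * b" using assms by (intro mult_strict_left_mono) auto
  then have C: "a < C" unfolding C_def by simp
  define m where "m = (a / C) powr (1 / (b - 1))"
  have aC: "0 < C" "0 < a / C" "a / C < 1" using C assms by auto
  have m: "0 < m" "m < 1" "m powr (b - 1) = a / C"
    unfolding m_def using aC assms powr_less_mono2[of "1 / (b - 1)" "a / C" 1]
    by (auto simp: powr_powr)
  have h: "h = (\<lambda>x. a * b * x - C * x powr b - (b - 1))" unfolding h_def C_def ..
  have cont: "continuous_on {u..v} h" if "0 \<le> u" for u v
    unfolding h using assms that by (intro continuous_intros continuous_on_powr') auto
  have der: "(h has_real_derivative b * (a - C * t powr (b - 1))) (at t)" if "0 < t" for t
    unfolding h using that by (auto intro!: derivative_eq_intros simp: algebra_simps)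
  have inc: "h u < h v" if "0 \<le> u" "u < v" "v \<le> m" for u v
  proof (rule DERIV_pos_imp_increasing_open[OF that(2)])
    fix t assume t: "u < t" "t < v"
    then have "t powr (b - 1) < a / C"
      using m(3) powr_less_mono2[of "b - 1" t m] that assms by auto
    then have "0 < a - C * t powr (b - 1)" using C assms by (simp add: field_simps)
    then show "\<exists>y. (h has_real_derivative y) (at t) \<and> 0 < y"
      using der[of t] t that assms by (intro exI conjI) auto
  qed (use cont that in auto)
  have dec: "h v < h u" if "m \<le> u" "u < v" for u v
  proof (rule DERIV_neg_imp_decreasing_open[OF that(2)])
    fix t assume t: "u < t" "t < v"
    then have "a / C < t powr (b - 1)"
      using m powr_less_mono2[of "b - 1" m t] that assms by auto
    then have "a - C * t powr (b - 1) < 0" using C assms by (simp add: field_simps)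
    then show "\<exists>y. (h has_real_derivative y) (at t) \<and> y < 0"
      using der[of t] t that m assms
      by (intro exI[of _ "b * (a - C * t powr (b - 1))"] conjI) (auto intro: mult_pos_neg)
  qed (use cont that m in auto)
  have h0: "h 0 < 0" and h1: "h 1 = 0"
    using assms by (auto simp: h_def algebra_simps)
  have hm: "0 < h m" using dec[of m 1] h1 m by simp
  obtain z where z: "0 \<le> z" "z \<le> m" "h z = 0"
    using IVT'[of h 0 0 m] h0 hm m cont[of 0 m] by auto
  have z': "0 < z" "z < m" using z h0 hm by (metis less_le, metis less_le less_irrefl)
  show ?thesis
  proof (rule that[of z])
    show "h x < 0" if "0 < x" "x < z" for x using inc[of x z] that z by simp
    show "0 < h x" if "z < x" "x < 1" for x
    proof (cases "x \<le> m")
      case True then show ?thesis using inc[of z x] that z by simp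
    next
      case False then show ?thesis using dec[of x 1] that h1 by simp
    qed
  qed (use z z' m in auto)
qed

lemma Y_F_pos:
  assumes "\<eta> > 0" "\<delta> > 0" "K > 0" "0 < D2"
  shows "Y_F r \<eta> \<delta> K D2 > 0"
  using beta_exp_gt_1[OF assms(1,2), of r] assms by (simp add: Y_F_def Let_def)

lemma payoff_differences:
  fixes r \<eta> \<delta> K D1 D2 x :: real
  assumes "\<eta> > 0" "\<delta> > 0" "K > 0" "0 < D2"
    and x: "0 < x" "x < 1"
  defines "b \<equiv> beta_exp r \<eta> \<delta>" and "y \<equiv> x * Y_F r \<eta> \<delta> K D2"
  shows "follower_val r \<eta> \<delta> K D2 y - simul_val \<delta> K D2 y
           = K / (b - 1) * (x powr b - (b * x - (b - 1)))"
    and "leader_val r \<eta> \<delta> K D1 D2 y - simul_val \<delta> K D2 y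
           = (D1 - D2) / D2 * (K * b / (b - 1)) * (x - x powr b)"
    and "leader_val r \<eta> \<delta> K D1 D2 y - follower_val r \<eta> \<delta> K D2 y
           = K / (b - 1) * (D1 / D2 * b * x - ((D1 / D2 - 1) * b + 1) * x powr b - (b - 1))"
proof -
  have b: "b > 1" unfolding b_def using beta_exp_gt_1 assms by simp
  have yF: "Y_F r \<eta> \<delta> K D2 > 0" by (rule Y_F_pos[OF assms(1-4)])
  then have y: "y < Y_F r \<eta> \<delta> K D2" "y / Y_F r \<eta> \<delta> K D2 = x"
    using x by (auto simp: y_def)
  have yv: "D * y / \<delta> = D / D2 * (K * b / (b - 1)) * x" for D
    using assms(1-4) b by (simp add: y_def Y_F_def Let_def b_def[symmetric])
  have F: "follower_val r \<eta> \<delta> K D2 y = K / (b - 1) * x powr b"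
    using y by (simp add: follower_val_def Let_def b_def)
  have L: "leader_val r \<eta> \<delta> K D1 D2 y
      = D1 / D2 * (K * b / (b - 1)) * x - (D1 - D2) / D2 * (K * b / (b - 1)) * x powr b - K"
    using y yv[of D1] by (simp add: leader_val_def Let_def b_def)
  have S: "simul_val \<delta> K D2 y = K * b / (b - 1) * x - K"
    using yv[of D2] assms(4) by (simp add: simul_val_def)
  define k where "k = K / (b - 1)"
  have kb: "K * b / (b - 1) = k * b" "(D1 - D2) / D2 = D1 / D2 - 1"
    "k = K / (b - 1)" "K = k * (b - 1)"
    using b assms(4) by (auto simp: k_def field_simps)
  show "follower_val r \<eta> \<delta> K D2 y - simul_val \<delta> K D2 y
           = K / (b - 1) * (x powr b - (b * x - (b - 1)))"
    and "leader_val r \<eta> \<delta> K D1 D2 y - simul_val \<delta> K D2 y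
           = (D1 - D2) / D2 * (K * b / (b - 1)) * (x - x powr b)"
    and "leader_val r \<eta> \<delta> K D1 D2 y - follower_val r \<eta> \<delta> K D2 y
           = K / (b - 1) * (D1 / D2 * b * x - ((D1 / D2 - 1) * b + 1) * x powr b - (b - 1))"
    unfolding F L S kb(1,2) unfolding kb(3)[symmetric] unfolding kb(4)
    by (simp_all add: algebra_simps diff_divide_distrib)
qed

lemma simul_lt:
  assumes "\<eta> > 0" "\<delta> > 0" "K > 0" "0 < D2" "D2 < D1"
    and y: "0 < y" "y < Y_F r \<eta> \<delta> K D2"
  shows "simul_val \<delta> K D2 y < follower_val r \<eta> \<delta> K D2 y"
    and "simul_val \<delta> K D2 y < leader_val r \<eta> \<delta> K D1 D2 y"
proof -
  define yF where "yF = Y_F r \<eta> \<delta> K D2"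
  define b where "b = beta_exp r \<eta> \<delta>"
  have b: "b > 1" unfolding b_def using beta_exp_gt_1 assms by simp
  have yF: "yF > 0" unfolding yF_def by (rule Y_F_pos[OF assms(1-4)])
  define x where "x = y / yF"
  have x: "0 < x" "x < 1" and yx: "y = x * yF"
    using y yF by (auto simp: x_def yF_def)
  note d = payoff_differences[OF assms(1-4) x, of r, folded yF_def b_def, folded yx]
  have "0 < K / (b - 1) * (x powr b - (b * x - (b - 1)))"
    using powr_gt_tangent[OF x b] b assms by (intro mult_pos_pos) auto
  then show "simul_val \<delta> K D2 y < follower_val r \<eta> \<delta> K D2 y" using d(1) by linarith
  have "0 < (D1 - D2) / D2 * (K * b / (b - 1)) * (x - x powr b)"
    using powr_lt_self[OF x b] b assms by (intro mult_pos_pos) auto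
  then show "simul_val \<delta> K D2 y < leader_val r \<eta> \<delta> K D1 D2 y" using d(2)[of D1] by linarith
qed

lemma ex1_Y_L:
  assumes "\<eta> > 0" "\<delta> > 0" "K > 0" "0 < D2" "D2 < D1"
  shows "\<exists>!z. is_Y_L r \<eta> \<delta> K D1 D2 z"
proof (rule ex_ex1I)
  define yF where "yF = Y_F r \<eta> \<delta> K D2"
  define b where "b = beta_exp r \<eta> \<delta>"
  have b: "b > 1" unfolding b_def using beta_exp_gt_1 assms by simp
  have yF: "yF > 0" unfolding yF_def by (rule Y_F_pos[OF assms(1-4)])
  have a: "D1 / D2 > 1" using assms by simp
  let ?h = "\<lambda>x. D1 / D2 * b * x - ((D1 / D2 - 1) * b + 1) * x powr b - (b - 1)"
  let ?L = "leader_val r \<eta> \<delta> K D1 D2" and ?F = "follower_val r \<eta> \<delta> K D2"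
  obtain z where z: "0 < z" "z < 1" "?h z = 0"
    "\<And>x. 0 < x \<Longrightarrow> x < z \<Longrightarrow> ?h x < 0" "\<And>x. z < x \<Longrightarrow> x < 1 \<Longrightarrow> 0 < ?h x"
    using single_crossing[OF a b] by metis
  have k: "0 < K / (b - 1)" using b assms by simp
  have LF: "?L y - ?F y = K / (b - 1) * ?h (y / yF)" if "0 < y" "y < yF" for y
    using payoff_differences(3)[OF assms(1-4), of "y / yF" r D1] that yF
    by (simp add: b_def yF_def)
  have "is_Y_L r \<eta> \<delta> K D1 D2 (z * yF)"
    unfolding is_Y_L_def Let_def yF_def[symmetric]
  proof (intro conjI ballI)
    show "z * yF \<in> {0<..<yF}" using z yF by simp
    then show "simul_val \<delta> K D2 (z * yF) < ?L (z * yF)"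
      using simul_lt(2)[OF assms] by (simp add: yF_def)
    show "?L (z * yF) = ?F (z * yF)" using LF[of "z * yF"] z yF by simp
  next
    fix y assume y: "y \<in> {0<..<z * yF}"
    moreover have "y < yF"
      using y mult_strict_right_mono[OF z(2) yF] unfolding greaterThanLessThan_iff by linarith
    ultimately have y': "0 < y" "y / yF < z" "y < yF"
      using yF by (simp_all add: divide_less_eq)
    show "simul_val \<delta> K D2 y < ?L y" using simul_lt(2)[OF assms] y' by (simp add: yF_def)
    have "?h (y / yF) < 0" by (rule z(4)) (use y' yF in simp_all)
    then have "K / (b - 1) * ?h (y / yF) < 0" by (rule mult_pos_neg[OF k])
    then show "?L y < ?F y" using LF[OF y'(1,3)] by linarith
  next
    fix y assume y: "y \<in> {z * yF<..<yF}"
    moreover have "0 < y"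
      using y mult_pos_pos[OF z(1) yF] unfolding greaterThanLessThan_iff by linarith
    ultimately have y': "0 < y" "z < y / yF" "y < yF"
      using yF by (simp_all add: less_divide_eq)
    show "simul_val \<delta> K D2 y < ?F y" using simul_lt(1)[OF assms] y' by (simp add: yF_def)
    have "0 < ?h (y / yF)" by (rule z(5)) (use y' yF in simp_all)
    then have "0 < K / (b - 1) * ?h (y / yF)" by (rule mult_pos_pos[OF k])
    then show "?F y < ?L y" using LF[OF y'(1,3)] by linarith
  qed
  then show "\<exists>z. is_Y_L r \<eta> \<delta> K D1 D2 z" ..
next
  fix z w assume zw: "is_Y_L r \<eta> \<delta> K D1 D2 z" "is_Y_L r \<eta> \<delta> K D1 D2 w"
  have "\<not> u < v" if "is_Y_L r \<eta> \<delta> K D1 D2 u" "is_Y_L r \<eta> \<delta> K D1 D2 v" for u v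
    using that unfolding is_Y_L_def Let_def by force
  then show "z = w" using zw by (metis linorder_neqE)
qed

lemma is_Y_L_Y_L:
  assumes "\<eta> > 0" "\<delta> > 0" "K > 0" "0 < D2" "D2 < D1"
  shows "is_Y_L r \<eta> \<delta> K D1 D2 (Y_L r \<eta> \<delta> K D1 D2)"
  unfolding Y_L_def by (rule theI'[OF ex1_Y_L[OF assms]])

lemma Y_S_regulator_simul:
  assumes "\<eta> > 0" "\<delta> > 0" "K > 0" "0 < D2" "D2 < D1"
  shows "Y_S r \<eta> \<delta> K D1 D2 0 1 = Y_F r \<eta> \<delta> K D2"
proof -
  let ?yF = "Y_F r \<eta> \<delta> K D2" and ?yL = "Y_L r \<eta> \<delta> K D1 D2"
  have yL: "0 < ?yL" "?yL < ?yF"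
    using is_Y_L_Y_L[OF assms, of r] by (auto simp: is_Y_L_def Let_def)
  have "beta_exp r \<eta> \<delta> > 1" using beta_exp_gt_1 assms by simp
  then have end_eq: "simul_val \<delta> K D2 ?yF = follower_val r \<eta> \<delta> K D2 ?yF"
    using assms(1-4) Y_F_pos[OF assms(1-4), of r]
    by (simp add: simul_val_def follower_val_def Let_def) (simp add: Y_F_def Let_def field_simps)
  show ?thesis unfolding Y_S_def
  proof (rule Least_equality)
    fix z assume z: "z \<in> {?yL..?yF} \<and>
      0 * leader_val r \<eta> \<delta> K D1 D2 z + 0 * follower_val r \<eta> \<delta> K D2 z + 1 * simul_val \<delta> K D2 z
        = follower_val r \<eta> \<delta> K D2 z"
    show "?yF \<le> z"
    proof (rule ccontr)
      assume "\<not> ?yF \<le> z"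
      then have "simul_val \<delta> K D2 z < follower_val r \<eta> \<delta> K D2 z"
        using simul_lt(1)[OF assms, of z r] z yL by simp
      then show False using z by simp
    qed
  qed (use yL end_eq in auto)
qed

end

theory Submission
  imports Defs "HOL-Real_Asymp.Real_Asymp"
begin

text \<open>On the given interval \<open>S < F < L\<close>. Multiplying numerator and denominator of \<open>p\<^sub>\<gamma>\<close> by
  \<open>exp (\<gamma> L)\<close> turns it into \<open>(exp (\<gamma> a) - 1) / (exp (\<gamma> b) - 1)\<close> with \<open>a = L - F\<close> and
  \<open>b = L - S\<close>, where \<open>0 < a < b\<close>. The upper bound \<open>a / b\<close> is the convexity of \<open>exp\<close> on
  \<open>[0, \<gamma> b]\<close>.\<close>

lemma expm1_ratio_le:
  fixes a b c :: real
  assumes "0 < a" "a < b" "0 < c"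
  shows "(exp (c * a) - 1) / (exp (c * b) - 1) \<le> a / b"
proof -
  have "convex_on UNIV (exp :: real \<Rightarrow> real)"
    by (rule exp_convex)
  \<comment> \<open>\<open>c * a\<close> is the convex combination of \<open>0\<close> and
    \<open>c * b\<close> with weight \<open>a / b\<close> on \<open>c * b\<close>.\<close>
  from convex_onD[OF this, of "a / b" 0 "c * b"]
  have "exp (c * a) \<le> (1 - a / b) + a / b * exp (c * b)"
    using assms by (simp add: mult.commute)
  then have "exp (c * a) - 1 \<le> a / b * (exp (c * b) - 1)"
    by (simp add: algebra_simps)
  then show ?thesis
    using assms by (simp add: pos_divide_le_eq)
qed

text \<open>To first order at 0, \<open>exp (c * a) - 1\<close> is \<open>c * a\<close>, and
  likewise for \<open>b\<close>.\<close>

lemma expm1_ratio_at_right_0: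
  fixes a b :: real
  assumes "0 < a" "a < b"
  shows "((\<lambda>c. (exp (c * a) - 1) / (exp (c * b) - 1)) \<longlongrightarrow> a / b) (at_right 0)"
  using assms by (real_asymp simp: field_simps)

text \<open>The quotient decays like \<open>exp (- c * (b - a))\<close>.\<close>

lemma expm1_ratio_at_top:
  fixes a b :: real
  assumes "0 < a" "a < b"
  shows "((\<lambda>c. (exp (c * a) - 1) / (exp (c * b) - 1)) \<longlongrightarrow> 0) at_top"
  using assms by real_asymp

lemma utility_ratio:
  "(utility c l - utility c f) / (utility c l - utility c s)
     = (exp (c * (l - f)) - 1) / (exp (c * (l - s)) - 1)"
proof -
  \<comment> \<open>Used with \<open>x = f\<close> and \<open>x = s\<close>: the common nonzero
    factor \<open>exp (- c * l)\<close> cancels.\<close>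
  have "utility c l - utility c x = exp (- c * l) * (exp (c * (l - x)) - 1)" for x
    by (simp add: utility_def right_diff_distrib exp_diff exp_minus field_simps)
  then show ?thesis by simp
qed

theorem proposition7:
  fixes r \<eta> \<delta> K D1 D2 q1 q2 qS y :: real
  assumes "\<eta> > 0" and "\<delta> > 0" and "K > 0" and "0 < D2" and "D2 < D1"
    and "q1 \<ge> 0" and "q2 \<ge> 0" and "qS \<ge> 0" and "q1 + q2 + qS = 1"
    and "qS = 1"
    and "y \<in> {Y_L r \<eta> \<delta> K D1 D2<..<Y_S r \<eta> \<delta> K D1 D2 q1 qS}"
  shows "(\<forall>\<gamma>>0. P_util r \<eta> \<delta> K D1 D2 q1 qS \<gamma> y = P_util r \<eta> \<delta> K D1 D2 q2 qS \<gamma> y) \<and>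
    (\<forall>\<gamma>>0. P_util r \<eta> \<delta> K D1 D2 q1 qS \<gamma> y \<le> p_zero r \<eta> \<delta> K D1 D2 y) \<and>
    ((\<lambda>\<gamma>. P_util r \<eta> \<delta> K D1 D2 q1 qS \<gamma> y) \<longlongrightarrow> p_zero r \<eta> \<delta> K D1 D2 y) (at_right 0) \<and>
    ((\<lambda>\<gamma>. P_util r \<eta> \<delta> K D1 D2 q1 qS \<gamma> y) \<longlongrightarrow> 0) at_top"
proof -
  have q: "q1 = 0" "q2 = 0" using assms(6-10) by linarith+
  define a where "a = leader_val r \<eta> \<delta> K D1 D2 y - follower_val r \<eta> \<delta> K D2 y"
  define b where "b = leader_val r \<eta> \<delta> K D1 D2 y - simul_val \<delta> K D2 y"
  \<comment> \<open>For \<open>q1 = 0\<close> and \<open>qS = 1\<close> the threshold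
    \<open>Y_S\<close> is \<open>Y_F\<close>, so \<open>y\<close> lies where the property of
    \<open>Y_L\<close> gives S < F < L.\<close>
  have "y \<in> {Y_L r \<eta> \<delta> K D1 D2<..<Y_F r \<eta> \<delta> K D2}"
    using assms(10,11) q Y_S_regulator_simul[OF assms(1-5), of r] by simp
  then have "simul_val \<delta> K D2 y < follower_val r \<eta> \<delta> K D2 y"
    "follower_val r \<eta> \<delta> K D2 y < leader_val r \<eta> \<delta> K D1 D2 y"
    using is_Y_L_Y_L[OF assms(1-5), of r] by (auto simp: is_Y_L_def Let_def)
  then have ab: "0 < a" "a < b" by (simp_all add: a_def b_def)
  have P: "P_util r \<eta> \<delta> K D1 D2 0 1 c y = (exp (c * a) - 1) / (exp (c * b) - 1)" for c
    by (simp add: P_util_def utility_ratio a_def b_def)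
  have p0: "p_zero r \<eta> \<delta> K D1 D2 y = a / b"
    by (simp add: p_zero_def a_def b_def)
  show ?thesis
    unfolding q \<open>qS = 1\<close> P p0
    using expm1_ratio_le[OF ab] expm1_ratio_at_right_0[OF ab] expm1_ratio_at_top[OF ab] by simp
qed

end
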